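(* Let $P\to X$ be a principal $\mathrm{Spin}(n)\langle k\rangle_{\mathbb{Q}}$-bundle over a (based) space $X$, where $\mathrm{Spin}(n)\langle k\rangle_{\mathbb{Q}}\simeq\prod_\alpha K(\mathbb{Q},m_\alpha)$. Then the unbased gauge group $\mathcal{G}$ and the based gauge group $\mathcal{G}_0$ of $P$ are given by the mapping spaces $$\mathcal{G}\simeq\mathrm{Map}\Big(X,\prod_\alpha K(\mathbb{Q},m_\alpha)\Big),\qquad \mathcal{G}_0\simeq\mathrm{Map}_*\Big(X,\prod_\alpha K(\mathbb{Q},m_\alpha)\Big).$$
   Context: $\mathrm{Spin}(n)\langle k\rangle$ is the $(k-1)$-connected cover of $\mathrm{Spin}(n)$, and $\mathrm{Spin}(n)\langle k\rangle_{\mathbb{Q}}$ is its rationalization, realized as an abelian topological group; it is equivalent, with its multiplication, to a product of rational Eilenberg–MacLane spaces $K(\mathbb{Q},m_\alpha)$ with standard loop multiplication. The gauge group $\mathcal{G}=\mathcal{G}(P)$ of a principal $G$-bundle $P\to X$ is the topological group of $G$-equivariant homeomorphisms of $P$ covering the identity of $X$. For a basepoint $x_0\in X$, the based gauge group $\mathcal{G}_0(P)$ is the subgroup of those $\eta\in\mathcal{G}(P)$ with $\eta(p)=p$ for all $p$ in the fiber $P_{x_0}$. $\mathrm{Map}$ and $\mathrm{Map}_*$ denote the spaces of unbased and based maps. *)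

theory Defs
  imports "HOL-Analysis.Analysis" "HOL-Algebra.Elementary_Groups" "HOL-Algebra.Bij"
begin

section \<open>Mapping spaces\<close>

text \<open>
  Mapping spaces carry the compact-open topology in the form used for spaces that are not
  assumed to be Hausdorff: the test sets are the images of compact Hausdorff spaces.  For a
  Hausdorff source these are exactly the compact subsets
  (\<open>compact_test_set_Hausdorff\<close>), so this is then the usual compact-open topology
  (\<open>mapping_space_Hausdorff\<close>).  Having the test spaces live on the type
  \<open>'a set set\<close> is no restriction (\<open>compact_test_setI\<close>).
\<close>

definition compact_test_set :: "'a topology \<Rightarrow> 'a set \<Rightarrow> bool" where
  "compact_test_set X C \<longleftrightarrow>
     (\<exists>(L :: 'a set set topology) u. compact_space L \<and> Hausdorff_space L \<and>
        continuous_map L X u \<and> C = u ` topspace L)"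

text \<open>Points of a mapping space are extensional functions, so that two of them are equal as
  soon as they agree on the source.\<close>

definition continuous_maps :: "'a topology \<Rightarrow> 'b topology \<Rightarrow> ('a \<Rightarrow> 'b) set" where
  "continuous_maps X Y = {f \<in> extensional (topspace X). continuous_map X Y f}"

definition mapping_space :: "'a topology \<Rightarrow> 'b topology \<Rightarrow> ('a \<Rightarrow> 'b) topology" where
  "mapping_space X Y = topology_generated_by
     {{f \<in> continuous_maps X Y. f ` C \<subseteq> U} | C U. compact_test_set X C \<and> openin Y U}"

definition based_mapping_space ::
    "'a topology \<Rightarrow> 'a \<Rightarrow> 'b topology \<Rightarrow> 'b \<Rightarrow> ('a \<Rightarrow> 'b) topology" where
  "based_mapping_space X x\<^sub>0 Y y\<^sub>0 = subtopology (mapping_space X Y) {f. f x\<^sub>0 = y\<^sub>0}"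

text \<open>A compact Hausdorff space mapping onto a set \<open>C\<close> has a closed subspace that still maps
  onto \<open>C\<close> and has a dense subset no larger than \<open>C\<close>; a point of such a subspace is
  determined by the parts of the dense subset to whose closure it belongs.\<close>

lemma compact_test_setI:
  fixes L :: "'k topology" and u :: "'k \<Rightarrow> 'a"
  assumes L: "compact_space L" "Hausdorff_space L" and u: "continuous_map L X u"
  shows "compact_test_set X (u ` topspace L)"
proof -
  let ?C = "u ` topspace L"
  define s where "s = inv_into (topspace L) u"
  have s: "s c \<in> topspace L" "u (s c) = c" if "c \<in> ?C" for c
    using that by (auto simp: s_def inv_into_into f_inv_into_f)
  define D where "D = L closure_of (s ` ?C)"
  define L' where "L' = subtopology L D"
  have D: "closedin L D" "D \<subseteq> topspace L"
    by (auto simp: D_def closure_of_subset_topspace)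
  have top: "topspace L' = D"
    using D by (auto simp: L'_def)
  have sD: "s ` ?C \<subseteq> D"
    unfolding D_def by (rule closure_of_subset) (use s in auto)
  have L': "compact_space L'" "Hausdorff_space L'"
    using L(1) D(1) closedin_compact_space[of L D] Hausdorff_space_subtopology[OF L(2), of D]
    unfolding L'_def
    by (simp_all add: compact_space_subtopology closedin_compact_space)
  have uL': "continuous_map L' X u"
    using u by (simp add: L'_def continuous_map_from_subtopology)
  have im: "?C = u ` D"
  proof
    show "?C \<subseteq> u ` D"
    proof
      fix c assume "c \<in> ?C"
      then have "s c \<in> D" "c = u (s c)" using s(2) sD by auto
      then show "c \<in> u ` D" by (rule rev_image_eqI)
    qed
  qed (use D(2) in auto)
  define j :: "'k \<Rightarrow> 'a set set" where "j = (\<lambda>k. {A. A \<subseteq> ?C \<and> k \<in> L closure_of (s ` A)})"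
  have inj: "inj_on j D"
  proof (rule inj_onI, rule ccontr)
    fix k l assume kl: "k \<in> D" "l \<in> D" "j k = j l" "k \<noteq> l"
    then have "k \<in> topspace L" "l \<in> topspace L" using D by auto
    with L kl obtain U V where UV: "openin L U" "openin L V" "k \<in> U" "l \<in> V" "disjnt U V"
      unfolding Hausdorff_space_def by metis
    define A where "A = {c \<in> ?C. s c \<in> U}"
    have "k \<in> L closure_of (s ` A)"
      unfolding in_closure_of
    proof (intro conjI allI impI)
      fix W assume W: "k \<in> W \<and> openin L W"
      then have "openin L (W \<inter> U)" "k \<in> W \<inter> U" using UV by auto
      then obtain y where "y \<in> s ` ?C" "y \<in> W \<inter> U"
        using kl(1) unfolding D_def in_closure_of by metis
      then show "\<exists>y. y \<in> s ` A \<and> y \<in> W" by (auto simp: A_def)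
    qed fact
    moreover have "l \<notin> L closure_of (s ` A)"
    proof
      assume "l \<in> L closure_of (s ` A)"
      then obtain y where "y \<in> s ` A" "y \<in> V"
        using UV unfolding in_closure_of by metis
      then show False using UV(5) by (auto simp: A_def disjnt_def)
    qed
    moreover have "A \<subseteq> ?C" by (auto simp: A_def)
    ultimately have "A \<in> j k" "A \<notin> j l" by (simp_all add: j_def)
    then show False using kl(3) by simp
  qed
  define i where "i = inv_into D j"
  define M where "M = pullback_topology (j ` D) i L'"
  have ij: "i (j k) = k" if "k \<in> D" for k
    using that inj by (simp add: i_def)
  have topM: "topspace M = j ` D"
    using ij by (auto simp: M_def topspace_pullback_topology top)
  have i: "continuous_map M L' i"
    using continuous_map_pullback[of L' L' "\<lambda>x. x" "j ` D" i]
    by (simp add: M_def comp_def)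
  have j: "continuous_map L' M j"
    unfolding M_def
  proof (rule continuous_map_pullback')
    show "continuous_map L' L' (i \<circ> j)"
      by (rule continuous_map_eq[OF continuous_map_id]) (simp add: top ij)
  qed (simp add: top subset_vimage_iff image_subset_iff)
  have "homeomorphic_maps L' M j i"
    using i j ij top topM by (simp add: homeomorphic_maps_def)
  then have "L' homeomorphic_space M"
    by (auto simp: homeomorphic_space_def)
  then have "compact_space M" "Hausdorff_space M"
    using L' by (simp_all add: homeomorphic_compact_space homeomorphic_Hausdorff_space)
  moreover have "continuous_map M X (u \<circ> i)"
    using i uL' by (rule continuous_map_compose)
  moreover have "?C = (u \<circ> i) ` topspace M"
    unfolding im topM by (simp add: image_comp[symmetric] image_image ij)
  ultimately show ?thesis
    unfolding compact_test_set_def by blast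
qed

lemma compact_test_set_imp_compactin: "compact_test_set X C \<Longrightarrow> compactin X C"
  unfolding compact_test_set_def compact_space_def by (auto intro: image_compactin)

lemma compact_test_set_Hausdorff:
  assumes "Hausdorff_space X"
  shows "compact_test_set X C \<longleftrightarrow> compactin X C"
proof
  assume C: "compactin X C"
  then have "topspace (subtopology X C) = C"
    by (auto dest: compactin_subset_topspace)
  moreover have "compact_test_set X (id ` topspace (subtopology X C))"
    by (rule compact_test_setI)
      (use C assms in \<open>auto simp: compact_space_subtopology Hausdorff_space_subtopology
        continuous_map_from_subtopology\<close>)
  ultimately show "compact_test_set X C" by simp
qed (rule compact_test_set_imp_compactin)

lemma mapping_space_Hausdorff:
  "Hausdorff_space X \<Longrightarrow> mapping_space X Y = topology_generated_by
     {{f \<in> continuous_maps X Y. f ` C \<subseteq> U} | C U. compactin X C \<and> openin Y U}"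
  by (simp add: mapping_space_def compact_test_set_Hausdorff)

lemma topspace_mapping_space [simp]: "topspace (mapping_space X Y) = continuous_maps X Y"
proof -
  have "compact_test_set X {}"
    unfolding compact_test_set_def by (rule exI[of _ "discrete_topology {}"]) auto
  then have "continuous_maps X Y \<in>
      {{f \<in> continuous_maps X Y. f ` C \<subseteq> U} | C U. compact_test_set X C \<and> openin Y U}"
    by (intro CollectI exI[of _ "{}"]) auto
  then show ?thesis
    unfolding mapping_space_def topology_generated_by_topspace by blast
qed


section \<open>Homotopy groups\<close>

definition cube :: "nat \<Rightarrow> (nat \<Rightarrow> real) topology" where
  "cube m = product_topology (\<lambda>_. top_of_set {0..1}) {..<m}"

definition cube_boundary :: "nat \<Rightarrow> (nat \<Rightarrow> real) set" where
  "cube_boundary m = {t \<in> topspace (cube m). \<exists>i<m. t i = 0 \<or> t i = 1}"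

definition homotopic_rel_boundary ::
    "nat \<Rightarrow> 'a topology \<Rightarrow> 'a \<Rightarrow> ((nat \<Rightarrow> real) \<Rightarrow> 'a) \<Rightarrow> ((nat \<Rightarrow> real) \<Rightarrow> 'a) \<Rightarrow> bool" where
  "homotopic_rel_boundary m X x = homotopic_with (\<lambda>f. \<forall>t\<in>cube_boundary m. f t = x) (cube m) X"

definition homotopy_class ::
    "nat \<Rightarrow> 'a topology \<Rightarrow> 'a \<Rightarrow> ((nat \<Rightarrow> real) \<Rightarrow> 'a) \<Rightarrow> ((nat \<Rightarrow> real) \<Rightarrow> 'a) set" where
  "homotopy_class m X x f = {g. homotopic_rel_boundary m X x f g}"

definition cube_join ::
    "((nat \<Rightarrow> real) \<Rightarrow> 'a) \<Rightarrow> ((nat \<Rightarrow> real) \<Rightarrow> 'a) \<Rightarrow> (nat \<Rightarrow> real) \<Rightarrow> 'a" where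
  "cube_join f g t = (if t 0 \<le> 1/2 then f (t(0 := 2 * t 0)) else g (t(0 := 2 * t 0 - 1)))"

text \<open>The group structure is meaningful for \<open>m > 0\<close>.  As the cube of dimension 0 is a point
  with empty boundary, the carrier for \<open>m = 0\<close> is the set of path components.\<close>

definition homotopy_group ::
    "nat \<Rightarrow> 'a topology \<Rightarrow> 'a \<Rightarrow> ((nat \<Rightarrow> real) \<Rightarrow> 'a) set monoid" where
  "homotopy_group m X x =
     \<lparr>carrier = {homotopy_class m X x f | f.
         continuous_map (cube m) X f \<and> (\<forall>t\<in>cube_boundary m. f t = x)},
      monoid.mult = (\<lambda>A B. \<Union>f\<in>A. \<Union>g\<in>B. homotopy_class m X x (cube_join f g)),
      one = homotopy_class m X x (\<lambda>_. x)\<rparr>"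

definition homotopy_group_map ::
    "nat \<Rightarrow> 'b topology \<Rightarrow> 'b \<Rightarrow> ('a \<Rightarrow> 'b)
       \<Rightarrow> ((nat \<Rightarrow> real) \<Rightarrow> 'a) set \<Rightarrow> ((nat \<Rightarrow> real) \<Rightarrow> 'b) set" where
  "homotopy_group_map m Y y h A = (\<Union>f\<in>A. homotopy_class m Y y (h \<circ> f))"


section \<open>Spin groups\<close>

text \<open>
  The real Clifford algebra on generators \<open>e\<^sub>0, \<dots>, e\<^bsub>n-1\<^esub>\<close> with \<open>e\<^sub>i\<^sup>2 = -1\<close> has the basis
  \<open>e\<^sub>A\<close> (ordered products) for \<open>A \<subseteq> {..<n}\<close>; an element is its coefficient function, zero
  outside \<open>Pow {..<n}\<close>.  In \<open>e\<^sub>A e\<^sub>B\<close> each pair \<open>i \<in> A\<close>, \<open>j \<in> B\<close> with \<open>j < i\<close> contributes a sign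
  from anticommutation and each pair with \<open>i = j\<close> the sign from \<open>e\<^sub>i\<^sup>2 = -1\<close>.
\<close>

definition clifford_mult ::
    "nat \<Rightarrow> (nat set \<Rightarrow> real) \<Rightarrow> (nat set \<Rightarrow> real) \<Rightarrow> nat set \<Rightarrow> real" where
  "clifford_mult n a b = (\<lambda>C. \<Sum>A\<in>Pow {..<n}. \<Sum>B\<in>Pow {..<n}.
     if sym_diff A B = C then (-1) ^ card {(i, j). i \<in> A \<and> j \<in> B \<and> j \<le> i} * a A * b B else 0)"

definition clifford_unit_vectors :: "nat \<Rightarrow> (nat set \<Rightarrow> real) set" where
  "clifford_unit_vectors n =
     {v. (\<forall>A. v A \<noteq> 0 \<longrightarrow> (\<exists>i<n. A = {i})) \<and> (\<Sum>i<n. (v {i})\<^sup>2) = 1}"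

inductive_set spin_group :: "nat \<Rightarrow> (nat set \<Rightarrow> real) set" for n :: nat where
  one: "(\<lambda>A. if A = {} then 1 else 0) \<in> spin_group n"
| mult: "\<lbrakk>a \<in> spin_group n; v \<in> clifford_unit_vectors n; w \<in> clifford_unit_vectors n\<rbrakk>
    \<Longrightarrow> clifford_mult n (clifford_mult n a v) w \<in> spin_group n"

definition spin_space :: "nat \<Rightarrow> (nat set \<Rightarrow> real) topology" where
  "spin_space n = top_of_set (spin_group n)"


section \<open>Connected covers, rationalizations and Eilenberg--MacLane spaces\<close>

text \<open>The \<open>(k-1)\<close>-connected cover: homotopy is killed in degrees \<open>< k\<close> and unchanged in
  degrees \<open>\<ge> k\<close>.\<close>

definition connected_cover :: "nat \<Rightarrow> 'c topology \<Rightarrow> 'y topology \<Rightarrow> ('c \<Rightarrow> 'y) \<Rightarrow> bool" where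
  "connected_cover k C Y p \<longleftrightarrow>
     topspace C \<noteq> {} \<and> continuous_map C Y p \<and>
     (\<forall>c\<in>topspace C.
        (\<forall>i<k. carrier (homotopy_group i C c) = {\<one>\<^bsub>homotopy_group i C c\<^esub>}) \<and>
        (\<forall>i\<ge>k. bij_betw (homotopy_group_map i Y (p c) p)
           (carrier (homotopy_group i C c)) (carrier (homotopy_group i Y (p c)))))"

definition rational_group :: "rat monoid" where
  "rational_group = \<lparr>carrier = UNIV, monoid.mult = (+), one = 0\<rparr>"

definition uniquely_divisible :: "('a, 'm) monoid_scheme \<Rightarrow> bool" where
  "uniquely_divisible H \<longleftrightarrow>
     (\<forall>N::nat. N > 0 \<longrightarrow> bij_betw (\<lambda>a. a [^]\<^bsub>H\<^esub> N) (carrier H) (carrier H))"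

text \<open>Rationalization of (nilpotent) groups; for abelian groups this says that \<open>B\<close> is a rational
  vector space and that the induced map from the tensor product of \<open>A\<close> with the rationals to
  \<open>B\<close> is an isomorphism.\<close>

definition group_rationalization ::
    "('a, 'm) monoid_scheme \<Rightarrow> ('b, 'n) monoid_scheme \<Rightarrow> ('a \<Rightarrow> 'b) \<Rightarrow> bool" where
  "group_rationalization A B h \<longleftrightarrow>
     h \<in> hom A B \<and> uniquely_divisible B \<and>
     (\<forall>a\<in>carrier A. h a = \<one>\<^bsub>B\<^esub> \<longrightarrow> (\<exists>N::nat. N > 0 \<and> a [^]\<^bsub>A\<^esub> N = \<one>\<^bsub>A\<^esub>)) \<and>
     (\<forall>b\<in>carrier B. \<exists>N::nat. N > 0 \<and> b [^]\<^bsub>B\<^esub> N \<in> h ` carrier A)"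

definition rationalization :: "'y topology \<Rightarrow> 'z topology \<Rightarrow> ('y \<Rightarrow> 'z) \<Rightarrow> bool" where
  "rationalization Y Z r \<longleftrightarrow>
     continuous_map Y Z r \<and>
     (\<forall>y\<in>topspace Y.
        bij_betw (homotopy_group_map 0 Z (r y) r)
          (carrier (homotopy_group 0 Y y)) (carrier (homotopy_group 0 Z (r y))) \<and>
        (\<forall>i\<ge>1. group_rationalization (homotopy_group i Y y) (homotopy_group i Z (r y))
           (homotopy_group_map i Z (r y) r)))"

definition rational_eilenberg_maclane :: "nat \<Rightarrow> 'a topology \<Rightarrow> 'a \<Rightarrow> bool" where
  "rational_eilenberg_maclane m X x \<longleftrightarrow>
     m \<ge> 1 \<and> x \<in> topspace X \<and> homotopy_group m X x \<cong> rational_group \<and>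
     (\<forall>i. i \<noteq> m \<longrightarrow> carrier (homotopy_group i X x) = {\<one>\<^bsub>homotopy_group i X x\<^esub>})"


section \<open>Spaces with multiplication\<close>

definition pointed_homotopic ::
    "'a topology \<Rightarrow> 'a \<Rightarrow> 'b topology \<Rightarrow> 'b \<Rightarrow> ('a \<Rightarrow> 'b) \<Rightarrow> ('a \<Rightarrow> 'b) \<Rightarrow> bool" where
  "pointed_homotopic X x Y y = homotopic_with (\<lambda>f. f x = y) X Y"

definition H_space :: "'a topology \<Rightarrow> 'a \<Rightarrow> ('a \<Rightarrow> 'a \<Rightarrow> 'a) \<Rightarrow> bool" where
  "H_space X x \<mu> \<longleftrightarrow>
     x \<in> topspace X \<and> continuous_map (prod_topology X X) X (\<lambda>(a, b). \<mu> a b) \<and>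
     pointed_homotopic X x X x (\<lambda>a. \<mu> a x) (\<lambda>a. a) \<and>
     pointed_homotopic X x X x (\<lambda>a. \<mu> x a) (\<lambda>a. a)"

text \<open>Pointed homotopy equivalence respecting the multiplications up to pointed homotopy.\<close>

definition H_equivalent ::
    "'a topology \<Rightarrow> 'a \<Rightarrow> ('a \<Rightarrow> 'a \<Rightarrow> 'a) \<Rightarrow> 'b topology \<Rightarrow> 'b \<Rightarrow> ('b \<Rightarrow> 'b \<Rightarrow> 'b) \<Rightarrow> bool" where
  "H_equivalent X x \<mu> Y y \<nu> \<longleftrightarrow>
     (\<exists>f g. continuous_map X Y f \<and> f x = y \<and> continuous_map Y X g \<and> g y = x \<and>
        pointed_homotopic X x X x (g \<circ> f) id \<and> pointed_homotopic Y y Y y (f \<circ> g) id \<and>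
        pointed_homotopic (prod_topology X X) (x, x) Y y
          (\<lambda>(a, b). f (\<mu> a b)) (\<lambda>(a, b). \<nu> (f a) (f b)))"

definition loop_space :: "'a topology \<Rightarrow> 'a \<Rightarrow> (real \<Rightarrow> 'a) topology" where
  "loop_space X x = subtopology (mapping_space (top_of_set {0..1}) X) {f. f 0 = x \<and> f 1 = x}"

definition constant_loop :: "'a \<Rightarrow> real \<Rightarrow> 'a" where
  "constant_loop x = (\<lambda>t\<in>{0..1}. x)"

definition loop_mult :: "(real \<Rightarrow> 'a) \<Rightarrow> (real \<Rightarrow> 'a) \<Rightarrow> real \<Rightarrow> 'a" where
  "loop_mult f g = restrict (\<lambda>t. if t \<le> 1/2 then f (2 * t) else g (2 * t - 1)) {0..1}"

definition product_mult ::
    "'i set \<Rightarrow> ('i \<Rightarrow> 'a \<Rightarrow> 'a \<Rightarrow> 'a) \<Rightarrow> ('i \<Rightarrow> 'a) \<Rightarrow> ('i \<Rightarrow> 'a) \<Rightarrow> 'i \<Rightarrow> 'a" where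
  "product_mult I \<mu> f g = (\<lambda>i\<in>I. \<mu> i (f i) (g i))"


section \<open>Principal bundles and gauge groups\<close>

definition topological_group :: "('g, 'm) monoid_scheme \<Rightarrow> 'g topology \<Rightarrow> bool" where
  "topological_group G T \<longleftrightarrow>
     group G \<and> topspace T = carrier G \<and>
     continuous_map (prod_topology T T) T (\<lambda>(a, b). a \<otimes>\<^bsub>G\<^esub> b) \<and>
     continuous_map T T (\<lambda>a. inv\<^bsub>G\<^esub> a)"

text \<open>A right action together with equivariant local trivializations; freeness and
  transitivity on the fibres follow from the latter.\<close>

definition principal_bundle ::
    "('g, 'm) monoid_scheme \<Rightarrow> 'g topology \<Rightarrow> 'p topology \<Rightarrow> 'x topology \<Rightarrow>
       ('p \<Rightarrow> 'x) \<Rightarrow> ('p \<Rightarrow> 'g \<Rightarrow> 'p) \<Rightarrow> bool" where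
  "principal_bundle G T P X \<pi> act \<longleftrightarrow>
     topological_group G T \<and> continuous_map P X \<pi> \<and>
     continuous_map (prod_topology P T) P (\<lambda>(p, a). act p a) \<and>
     (\<forall>p\<in>topspace P. act p \<one>\<^bsub>G\<^esub> = p) \<and>
     (\<forall>p\<in>topspace P. \<forall>a\<in>carrier G. \<forall>b\<in>carrier G. act (act p a) b = act p (a \<otimes>\<^bsub>G\<^esub> b)) \<and>
     (\<forall>p\<in>topspace P. \<forall>a\<in>carrier G. \<pi> (act p a) = \<pi> p) \<and>
     (\<forall>x\<in>topspace X. \<exists>U h. openin X U \<and> x \<in> U \<and>
        homeomorphic_map (prod_topology (subtopology X U) T)
          (subtopology P {p \<in> topspace P. \<pi> p \<in> U}) h \<and>
        (\<forall>y\<in>U. \<forall>a\<in>carrier G. \<pi> (h (y, a)) = y) \<and>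
        (\<forall>y\<in>U. \<forall>a\<in>carrier G. \<forall>b\<in>carrier G. act (h (y, a)) b = h (y, a \<otimes>\<^bsub>G\<^esub> b)))"

definition gauge_group ::
    "('g, 'm) monoid_scheme \<Rightarrow> 'p topology \<Rightarrow> ('p \<Rightarrow> 'x) \<Rightarrow> ('p \<Rightarrow> 'g \<Rightarrow> 'p) \<Rightarrow> ('p \<Rightarrow> 'p) monoid" where
  "gauge_group G P \<pi> act = BijGroup (topspace P)
     \<lparr>carrier := {\<eta> \<in> Bij (topspace P). homeomorphic_map P P \<eta> \<and>
        (\<forall>p\<in>topspace P. \<forall>a\<in>carrier G. \<eta> (act p a) = act (\<eta> p) a) \<and>
        (\<forall>p\<in>topspace P. \<pi> (\<eta> p) = \<pi> p)}\<rparr>"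

definition based_gauge_group ::
    "('g, 'm) monoid_scheme \<Rightarrow> 'p topology \<Rightarrow> ('p \<Rightarrow> 'x) \<Rightarrow> ('p \<Rightarrow> 'g \<Rightarrow> 'p) \<Rightarrow> 'x \<Rightarrow>
       ('p \<Rightarrow> 'p) monoid" where
  "based_gauge_group G P \<pi> act x\<^sub>0 = gauge_group G P \<pi> act
     \<lparr>carrier := {\<eta> \<in> carrier (gauge_group G P \<pi> act).
        \<forall>p\<in>topspace P. \<pi> p = x\<^sub>0 \<longrightarrow> \<eta> p = p}\<rparr>"

definition gauge_space ::
    "('g, 'm) monoid_scheme \<Rightarrow> 'p topology \<Rightarrow> ('p \<Rightarrow> 'x) \<Rightarrow> ('p \<Rightarrow> 'g \<Rightarrow> 'p) \<Rightarrow> ('p \<Rightarrow> 'p) topology" where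
  "gauge_space G P \<pi> act = subtopology (mapping_space P P) (carrier (gauge_group G P \<pi> act))"

definition based_gauge_space ::
    "('g, 'm) monoid_scheme \<Rightarrow> 'p topology \<Rightarrow> ('p \<Rightarrow> 'x) \<Rightarrow> ('p \<Rightarrow> 'g \<Rightarrow> 'p) \<Rightarrow> 'x \<Rightarrow>
       ('p \<Rightarrow> 'p) topology" where
  "based_gauge_space G P \<pi> act x\<^sub>0 =
     subtopology (mapping_space P P) (carrier (based_gauge_group G P \<pi> act x\<^sub>0))"

end

theory Submission
  imports Defs
begin

text \<open>
  For an abelian structure group \<open>G\<close>, a bundle automorphism translates each fibre by a single
  element of \<open>G\<close>: if \<open>\<eta> p = p a\<close> then \<open>\<eta> (p b) = (p b) a\<close>.  This identifies the gauge
  group with the space of maps from \<open>X\<close> to \<open>G\<close>; local sections show that the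
  identification is a homeomorphism, and it matches based gauge transformations with based maps.
  A pointed homotopy equivalence from \<open>G\<close> to the product of Eilenberg--MacLane spaces then
  induces a homotopy equivalence of mapping spaces by composition.
\<close>

section \<open>Continuity of maps into mapping spaces\<close>

lemma continuous_mapsD:
  assumes "f \<in> continuous_maps X Y"
  shows "continuous_map X Y f" "f \<in> extensional (topspace X)"
  using assms by (auto simp: continuous_maps_def)

lemma continuous_maps_eqI:
  "\<lbrakk>f \<in> continuous_maps X Y; g \<in> continuous_maps X Y; \<And>x. x \<in> topspace X \<Longrightarrow> f x = g x\<rbrakk> \<Longrightarrow> f = g"
  by (auto dest: continuous_mapsD intro: extensionalityI)

lemma restrict_in_continuous_maps:
  "continuous_map X Y f \<Longrightarrow> restrict f (topspace X) \<in> continuous_maps X Y"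
  by (auto simp: continuous_maps_def intro: continuous_map_eq)

lemma openin_mapping_space:
  "\<lbrakk>compact_test_set X C; openin Y U\<rbrakk>
    \<Longrightarrow> openin (mapping_space X Y) {f \<in> continuous_maps X Y. f ` C \<subseteq> U}"
  unfolding mapping_space_def by (rule topology_generated_by_Basis) blast

text \<open>The same compact Hausdorff space tests the image, with its parametrization followed by
  \<open>f\<close>. \<open>compact_test_setI\<close> moves it from the type
  \<open>'a set set\<close> to \<open>'b set set\<close>.\<close>

lemma compact_test_set_compose:
  fixes X :: "'a topology" and Y :: "'b topology"
  assumes "compact_test_set X C" "continuous_map X Y f"
  shows "compact_test_set Y (f ` C)"
proof -
  obtain L :: "'a set set topology" and u where
    L: "compact_space L" "Hausdorff_space L" "continuous_map L X u" and C: "C = u ` topspace L"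
    using assms(1) unfolding compact_test_set_def by blast
  have "f ` C = (f \<circ> u) ` topspace L" by (simp add: C image_comp)
  then show ?thesis
    using compact_test_setI[OF L(1,2) continuous_map_compose[OF L(3) assms(2)]] by simp
qed

text \<open>A closed subspace of a compact Hausdorff space is again a valid test space. Continuity
  of \<open>u\<close> is asked only on \<open>D\<close>, since later \<open>u\<close> is a composite
  with a section defined over just part of the base.\<close>

lemma compact_test_set_image_closedin:
  assumes "compact_space L" "Hausdorff_space L" "closedin L D"
    and "continuous_map (subtopology L D) X u"
  shows "compact_test_set X (u ` D)"
proof -
  have "compact_space (subtopology L D)" "Hausdorff_space (subtopology L D)"
    using assms(1-3)
    by (simp_all add: closedin_compact_space compact_space_subtopology Hausdorff_space_subtopology)
  moreover have "topspace (subtopology L D) = D"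
    using closedin_subset[OF assms(3)] by auto
  ultimately show ?thesis
    using compact_test_setI assms(4) by metis
qed

text \<open>Regularity shrinks each neighbourhood satisfying \<open>R\<close> to a closed set that
  still contains an open set around the point. By compactness finitely many of these open sets
  cover, hence so do the closed sets around them. The pieces must be closed to serve as test spaces
  themselves.\<close>

lemma compact_Hausdorff_finite_closed_refinement:
  assumes L: "compact_space L" "Hausdorff_space L"
    and cover: "\<And>l. l \<in> topspace L \<Longrightarrow> \<exists>V. openin L V \<and> l \<in> V \<and> R V"
  obtains \<D> where "finite \<D>" "\<Union>\<D> = topspace L"
    "\<And>D. D \<in> \<D> \<Longrightarrow> closedin L D \<and> (\<exists>V. D \<subseteq> V \<and> R V)"
proof -
  have base: "neighbourhood_base_of (closedin L) L"
    using L by (simp add: neighbourhood_base_of_closedin compact_Hausdorff_imp_regular_space)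
  define Q where "Q A D \<longleftrightarrow> A \<subseteq> D \<and> closedin L D \<and> (\<exists>V. D \<subseteq> V \<and> R V)" for A D
  have "\<exists>A. openin L A \<and> l \<in> A \<and> (\<exists>D. Q A D)" if "l \<in> topspace L" for l
  proof -
    from cover[OF that] obtain V where "openin L V" "l \<in> V" "R V" by blast
    then show ?thesis
      using base unfolding neighbourhood_base_of Q_def by meson
  qed
  then have "topspace L \<subseteq> \<Union>{A. openin L A \<and> (\<exists>D. Q A D)}" by blast
  from compactinD[OF L(1)[unfolded compact_space_def] _ this]
  obtain \<A> where \<A>: "finite \<A>" "\<A> \<subseteq> {A. openin L A \<and> (\<exists>D. Q A D)}" "topspace L \<subseteq> \<Union>\<A>"
    by blast
  then have "\<forall>A\<in>\<A>. \<exists>D. Q A D" by blast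
  from bchoice[OF this] obtain d where d: "\<And>A. A \<in> \<A> \<Longrightarrow> Q A (d A)" by blast
  show thesis
  proof (rule that[of "d ` \<A>"])
    show "finite (d ` \<A>)" using \<A>(1) by simp
    show "\<Union>(d ` \<A>) = topspace L"
    proof
      show "\<Union>(d ` \<A>) \<subseteq> topspace L"
        using d closedin_subset unfolding Q_def by fastforce
      show "topspace L \<subseteq> \<Union>(d ` \<A>)"
        using d \<A>(3) unfolding Q_def by fastforce
    qed
  qed (use d in \<open>auto simp: Q_def\<close>)
qed

text \<open>Continuity may be tested locally on the compact Hausdorff test space, because finitely many
  closed subspaces subordinate to a given open cover suffice to cover it.\<close>

lemma continuous_map_into_mapping_spaceI:
  fixes X :: "'a topology"
  assumes maps: "\<And>w. w \<in> topspace W \<Longrightarrow> \<Phi> w \<in> continuous_maps X Y"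
    and local: "\<And>(L :: 'a set set topology) u U w l.
      \<lbrakk>compact_space L; Hausdorff_space L; continuous_map L X u; openin Y U; w \<in> topspace W;
       l \<in> topspace L; \<Phi> w (u l) \<in> U\<rbrakk>
      \<Longrightarrow> \<exists>V. openin L V \<and> l \<in> V \<and>
          (\<forall>D. closedin L D \<and> D \<subseteq> V \<and> \<Phi> w ` u ` D \<subseteq> U \<longrightarrow>
             (\<exists>N. openin W N \<and> w \<in> N \<and> (\<forall>v\<in>N. \<Phi> v ` u ` D \<subseteq> U)))"
  shows "continuous_map W (mapping_space X Y) \<Phi>"
proof -
  have "openin W (\<Phi> -` {f \<in> continuous_maps X Y. f ` C \<subseteq> U} \<inter> topspace W)"
    if C: "compact_test_set X C" and U: "openin Y U" for C U
  proof -
    obtain L :: "'a set set topology" and u where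
      L: "compact_space L" "Hausdorff_space L" and u: "continuous_map L X u" and
      Cu: "C = u ` topspace L"
      using C unfolding compact_test_set_def by blast
    show ?thesis
    proof (subst openin_subopen, intro ballI)
      fix w assume "w \<in> \<Phi> -` {f \<in> continuous_maps X Y. f ` C \<subseteq> U} \<inter> topspace W"
      then have w: "w \<in> topspace W" "\<Phi> w ` C \<subseteq> U" by auto
      \<comment> \<open>\<open>R V\<close> says that the test set for any closed piece inside
        \<open>V\<close> can be controlled by a neighbourhood of \<open>w\<close>; the assumption
        \<open>local\<close> supplies such a \<open>V\<close> around every point.\<close>
      define R where "R V \<longleftrightarrow> (\<forall>D. closedin L D \<and> D \<subseteq> V \<and> \<Phi> w ` u ` D \<subseteq> U \<longrightarrow>
             (\<exists>N. openin W N \<and> w \<in> N \<and> (\<forall>v\<in>N. \<Phi> v ` u ` D \<subseteq> U)))" for V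
      have "\<exists>V. openin L V \<and> l \<in> V \<and> R V" if "l \<in> topspace L" for l
        unfolding R_def by (rule local[OF L u U w(1) that]) (use w(2) Cu that in auto)
      then obtain \<D> where \<D>: "finite \<D>" "\<Union>\<D> = topspace L"
        "\<And>D. D \<in> \<D> \<Longrightarrow> closedin L D \<and> (\<exists>V. D \<subseteq> V \<and> R V)"
        using compact_Hausdorff_finite_closed_refinement[OF L, of R] by metis
      have "\<exists>N. openin W N \<and> w \<in> N \<and> (\<forall>v\<in>N. \<Phi> v ` u ` D \<subseteq> U)" if "D \<in> \<D>" for D
      proof -
        from \<D>(3)[OF that] obtain V where V: "closedin L D" "D \<subseteq> V" "R V" by blast
        have "\<Phi> w ` u ` D \<subseteq> U"
          using w(2) Cu that \<D>(2) by blast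
        then show ?thesis
          by (rule V(3)[unfolded R_def, rule_format, OF conjI[OF V(1) conjI[OF V(2)]]])
      qed
      then have "\<forall>D\<in>\<D>. \<exists>N. openin W N \<and> w \<in> N \<and> (\<forall>v\<in>N. \<Phi> v ` u ` D \<subseteq> U)" by (rule ballI)
      from bchoice[OF this] obtain N
        where N: "\<forall>D\<in>\<D>. openin W (N D) \<and> w \<in> N D \<and> (\<forall>v\<in>N D. \<Phi> v ` u ` D \<subseteq> U)" ..
      \<comment> \<open>The family is empty when \<open>L\<close> is empty, and then the
        intersection is \<open>UNIV\<close>; meeting it with \<open>topspace W\<close> keeps
        \<open>M\<close> open in that case too.\<close>
      define M where "M = topspace W \<inter> \<Inter>(N ` \<D>)"
      have "openin W M"
      proof (cases "\<D> = {}")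
        case False
        with \<D>(1) N have "openin W (\<Inter>(N ` \<D>))" by (intro openin_Inter) blast+
        then show ?thesis unfolding M_def by (rule openin_Int[OF openin_topspace])
      qed (simp add: M_def)
      moreover have "w \<in> M" using w N by (simp add: M_def)
      moreover have "M \<subseteq> \<Phi> -` {f \<in> continuous_maps X Y. f ` C \<subseteq> U} \<inter> topspace W"
      proof
        fix v assume v: "v \<in> M"
        have "\<Phi> v ` u ` D \<subseteq> U" if "D \<in> \<D>" for D
          using bspec[OF N that] v that by (simp add: M_def)
        then have "\<Phi> v ` C \<subseteq> U"
          unfolding Cu \<D>(2)[symmetric] by blast
        moreover have "v \<in> topspace W" using v by (simp add: M_def)
        ultimately show "v \<in> \<Phi> -` {f \<in> continuous_maps X Y. f ` C \<subseteq> U} \<inter> topspace W"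
          using maps by simp
      qed
      ultimately show "\<exists>M. openin W M \<and> w \<in> M \<and>
          M \<subseteq> \<Phi> -` {f \<in> continuous_maps X Y. f ` C \<subseteq> U} \<inter> topspace W"
        by blast
    qed
  qed
  \<comment> \<open>Continuity into a generated topology needs, besides open preimages of the
    generators, that all values lie in their union.\<close>
  moreover have "\<Phi> ` topspace W \<subseteq> \<Union>{{f \<in> continuous_maps X Y. f ` C \<subseteq> U} | C U.
      compact_test_set X C \<and> openin Y U}"
    using maps topspace_mapping_space[of X Y]
    unfolding mapping_space_def topology_generated_by_topspace by blast
  ultimately show ?thesis
    unfolding mapping_space_def continuous_on_generated_topo_iff by blast
qed

text \<open>The composite with \<open>p\<close> sends a test set into \<open>U\<close> exactly when
  the original map sends the image of that test set under \<open>p\<close> into \<open>U\<close>,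
  and this image is again a test set.\<close>

lemma continuous_map_mapping_space_precompose:
  assumes p: "continuous_map P X p"
  shows "continuous_map (mapping_space X Y) (mapping_space P Y) (\<lambda>f. \<lambda>a\<in>topspace P. f (p a))"
proof (rule continuous_map_into_mapping_spaceI)
  fix f assume "f \<in> topspace (mapping_space X Y)"
  then show "(\<lambda>a\<in>topspace P. f (p a)) \<in> continuous_maps P Y"
    using continuous_map_compose[OF p, of Y f]
    by (intro restrict_in_continuous_maps) (auto simp: continuous_maps_def comp_def)
next
  fix L :: "'a set set topology" and u U f l
  assume L: "compact_space L" "Hausdorff_space L" and u: "continuous_map L P u"
    and U: "openin Y U" and f: "f \<in> topspace (mapping_space X Y)" and l: "l \<in> topspace L"
  have key: "\<exists>N. openin (mapping_space X Y) N \<and> f \<in> N \<and>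
      (\<forall>g\<in>N. (\<lambda>a\<in>topspace P. g (p a)) ` u ` D \<subseteq> U)"
    if D: "closedin L D" and sub: "(\<lambda>a\<in>topspace P. f (p a)) ` u ` D \<subseteq> U" for D
  proof -
    have uD: "u ` D \<subseteq> topspace P"
      using u closedin_subset[OF D] continuous_map_image_subset_topspace by blast
    have eq: "(\<lambda>a\<in>topspace P. g (p a)) ` u ` D = g ` p ` u ` D" for g
      unfolding image_image by (intro image_cong refl restrict_apply') (use uD in blast)
    let ?N = "{g \<in> continuous_maps X Y. g ` p ` u ` D \<subseteq> U}"
    have "compact_test_set P (u ` D)"
      using L D u by (auto intro: compact_test_set_image_closedin continuous_map_from_subtopology)
    then have "openin (mapping_space X Y) ?N"
      by (intro openin_mapping_space compact_test_set_compose[OF _ p] U)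
    moreover have "f \<in> ?N"
      using f sub unfolding eq by simp
    ultimately show ?thesis
      unfolding eq by blast
  qed
  show "\<exists>V. openin L V \<and> l \<in> V \<and> (\<forall>D. closedin L D \<and> D \<subseteq> V \<and>
      (\<lambda>a\<in>topspace P. f (p a)) ` u ` D \<subseteq> U \<longrightarrow>
      (\<exists>N. openin (mapping_space X Y) N \<and> f \<in> N \<and>
        (\<forall>g\<in>N. (\<lambda>a\<in>topspace P. g (p a)) ` u ` D \<subseteq> U)))"
    \<comment> \<open>No localization is required here, so the whole test space serves as
      \<open>V\<close>.\<close>
    by (rule exI[of _ "topspace L"])
      (intro conjI openin_topspace l allI impI, elim conjE, rule key)
qed

text \<open>This is the common source of the continuity of post-composition, of the induced
  homotopies and of \<open>gauge_of\<close>. Joint continuity of evaluation on a mapping space is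
  avoided: on a small closed piece of the test space, requiring the values of
  \<open>\<Psi> v\<close> to stay in a fixed open set is already an open condition on
  \<open>v\<close>.\<close>

lemma continuous_map_mapping_space_fibrewise:
  assumes F: "continuous_map (prod_topology W (prod_topology X Y)) Z (\<lambda>(w, x, y). F w x y)"
    and \<Psi>: "continuous_map W (mapping_space X Y) \<Psi>"
  shows "continuous_map W (mapping_space X Z) (\<lambda>w. \<lambda>x\<in>topspace X. F w x (\<Psi> w x))"
proof (rule continuous_map_into_mapping_spaceI)
  have \<Psi>in: "\<Psi> w \<in> continuous_maps X Y" if "w \<in> topspace W" for w
    using funcset_mem[OF continuous_map_funspace[OF \<Psi>] that] by simp
  note \<Psi>c = continuous_mapsD(1)[OF \<Psi>in]
  show "(\<lambda>x\<in>topspace X. F w x (\<Psi> w x)) \<in> continuous_maps X Z" if w: "w \<in> topspace W" for w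
  proof (rule restrict_in_continuous_maps)
    have "continuous_map X (prod_topology W (prod_topology X Y)) (\<lambda>x. (w, x, \<Psi> w x))"
      using \<Psi>c[OF w] w by (intro continuous_map_pairedI) auto
    from continuous_map_compose[OF this F]
    show "continuous_map X Z (\<lambda>x. F w x (\<Psi> w x))" by (simp add: comp_def)
  qed
  fix L :: "'b set set topology" and u U w l
  assume L: "compact_space L" "Hausdorff_space L" and u: "continuous_map L X u"
    and U: "openin Z U" and w: "w \<in> topspace W" and l: "l \<in> topspace L"
    and inU: "(\<lambda>x\<in>topspace X. F w x (\<Psi> w x)) (u l) \<in> U"
  have uX: "u k \<in> topspace X" if "k \<in> topspace L" for k
    by (rule funcset_mem[OF continuous_map_funspace[OF u] that])
  have \<Psi>Y: "\<Psi> w x \<in> topspace Y" if "x \<in> topspace X" for x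
    by (rule funcset_mem[OF continuous_map_funspace[OF \<Psi>c[OF w]] that])
  let ?O = "{q \<in> topspace (prod_topology W (prod_topology X Y)). (\<lambda>(w, x, y). F w x y) q \<in> U}"
  have O_open: "openin (prod_topology W (prod_topology X Y)) ?O"
    by (rule openin_continuous_map_preimage[OF F U])
  have O_mem: "(w, u l, \<Psi> w (u l)) \<in> ?O"
    using w l uX \<Psi>Y inU by simp
  \<comment> \<open>Splitting the product twice gives a box \<open>A \<times> B \<times> C\<close>
    around \<open>(w, u l, \<Psi> w (u l))\<close> that \<open>F\<close> maps into
    \<open>U\<close>.\<close>
  obtain A S where AS: "openin W A" "openin (prod_topology X Y) S"
    "w \<in> A" "(u l, \<Psi> w (u l)) \<in> S" "A \<times> S \<subseteq> ?O"
    using openin_prod_topology_alt[THEN iffD1, rule_format, OF O_open O_mem]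
    by (elim exE conjE) (rule that)
  obtain B C where BC: "openin X B" "openin Y C" "u l \<in> B" "\<Psi> w (u l) \<in> C" "B \<times> C \<subseteq> S"
    using openin_prod_topology_alt[THEN iffD1, rule_format, OF AS(2,4)]
    by (elim exE conjE) (rule that)
  \<comment> \<open>For \<open>k\<close> in this set, \<open>(u k, \<Psi> w (u k))\<close> lies in
    \<open>B \<times> C\<close>. A closed piece inside it therefore gives a test set that
    \<open>\<Psi> w\<close> sends into \<open>C\<close>.\<close>
  let ?V = "{k \<in> topspace L. u k \<in> B} \<inter> {k \<in> topspace L. (\<Psi> w \<circ> u) k \<in> C}"
  have V: "openin L ?V"
    by (intro openin_Int openin_continuous_map_preimage[OF u BC(1)]
        openin_continuous_map_preimage[OF continuous_map_compose[OF u \<Psi>c[OF w]] BC(2)])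
  have key: "\<exists>N. openin W N \<and> w \<in> N \<and> (\<forall>v\<in>N. (\<lambda>x\<in>topspace X. F v x (\<Psi> v x)) ` u ` D \<subseteq> U)"
    if D: "closedin L D" "D \<subseteq> ?V" for D
  proof -
    have "compact_test_set X (u ` D)"
      using L D u by (auto intro: compact_test_set_image_closedin continuous_map_from_subtopology)
    then have "openin (mapping_space X Y) {f \<in> continuous_maps X Y. f ` u ` D \<subseteq> C}"
      using BC by (intro openin_mapping_space)
    from openin_continuous_map_preimage[OF \<Psi> this]
    have "openin W {v \<in> topspace W. \<Psi> v ` u ` D \<subseteq> C}"
      by (rule back_subst[of "openin W"]) (use \<Psi>in in auto)
    then have N: "openin W (A \<inter> {v \<in> topspace W. \<Psi> v ` u ` D \<subseteq> C})" (is "openin W ?N")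
      by (rule openin_Int[OF AS(1)])
    have wN: "w \<in> ?N"
      using w AS(3) D(2) by auto
    have "(\<lambda>x\<in>topspace X. F v x (\<Psi> v x)) ` u ` D \<subseteq> U" if v: "v \<in> ?N" for v
    proof clarify
      fix k assume k: "k \<in> D"
      have "(v, u k, \<Psi> v (u k)) \<in> ?O" using v k D(2) AS(5) BC(5) by blast
      then show "(\<lambda>x\<in>topspace X. F v x (\<Psi> v x)) (u k) \<in> U" by simp
    qed
    then show ?thesis using N wN by (intro exI[of _ ?N] conjI ballI)
  qed
  have "l \<in> ?V" using l BC(3,4) by simp
  with V show "\<exists>V. openin L V \<and> l \<in> V \<and> (\<forall>D. closedin L D \<and> D \<subseteq> V \<and>
      (\<lambda>x\<in>topspace X. F w x (\<Psi> w x)) ` u ` D \<subseteq> U \<longrightarrow>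
      (\<exists>N. openin W N \<and> w \<in> N \<and> (\<forall>v\<in>N. (\<lambda>x\<in>topspace X. F v x (\<Psi> v x)) ` u ` D \<subseteq> U)))"
    by (intro exI[of _ ?V] conjI allI impI; (elim conjE)?) (assumption | rule key)+
qed


section \<open>Homotopy invariance of mapping spaces\<close>

text \<open>Instance of the fibrewise lemma in which \<open>\<Psi>\<close> is the identity and
  \<open>F\<close> applies \<open>g\<close> to its last argument.\<close>

lemma continuous_map_mapping_space_compose:
  assumes "continuous_map Y Z g"
  shows "continuous_map (mapping_space X Y) (mapping_space X Z) (compose (topspace X) g)"
proof -
  have "continuous_map (prod_topology (mapping_space X Y) (prod_topology X Y)) Z
      (\<lambda>(w, x, y). g y)"
    using continuous_map_compose[OF
        continuous_map_compose[OF continuous_map_snd continuous_map_snd] assms]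
    by (simp add: comp_def case_prod_unfold)
  from continuous_map_mapping_space_fibrewise[OF this continuous_map_id[unfolded id_def]]
  show ?thesis unfolding compose_def[abs_def] .
qed

text \<open>The fibrewise lemma is applied with the homotopy parameter included in \<open>W\<close>.
  The predicate records that every stage sends based maps to based maps, so one homotopy serves both
  the unbased and the based mapping spaces.\<close>

lemma homotopic_mapping_space_compose:
  assumes fg: "homotopic_with (\<lambda>h. h y = z) Y Z f g" and x: "x \<in> topspace X"
  shows "homotopic_with (\<lambda>h. h \<in> {\<phi> \<in> continuous_maps X Y. \<phi> x = y} \<rightarrow> {\<phi>. \<phi> x = z})
    (mapping_space X Y) (mapping_space X Z) (compose (topspace X) f) (compose (topspace X) g)"
proof -
  let ?I = "top_of_set {0..1::real}"
  obtain h where h: "continuous_map (prod_topology ?I Y) Z h"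
    "\<And>y. h (0, y) = f y" "\<And>y. h (1, y) = g y" "\<And>t. t \<in> {0..1} \<Longrightarrow> h (t, y) = z"
    using fg unfolding homotopic_with_def by blast
  let ?W = "prod_topology ?I (mapping_space X Y)"
  define H where "H = (\<lambda>w. \<lambda>x\<in>topspace X. h (fst w, snd w x))"
  have "continuous_map (prod_topology ?W (prod_topology X Y)) (prod_topology ?I Y)
      (\<lambda>q. (fst (fst q), snd (snd q)))"
    using continuous_map_pairedI[OF continuous_map_fst_of[OF continuous_map_fst]
        continuous_map_snd_of[OF continuous_map_snd]]
    by (simp add: comp_def)
  from continuous_map_compose[OF this h(1)]
  have "continuous_map (prod_topology ?W (prod_topology X Y)) Z (\<lambda>(w, x, y). h (fst w, y))"
    by (simp add: comp_def case_prod_unfold)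
  from continuous_map_mapping_space_fibrewise[OF this continuous_map_snd]
  have "continuous_map ?W (mapping_space X Z) H"
    by (simp add: H_def)
  then show ?thesis
    unfolding homotopic_with_def using h(2-4) x
    by (intro exI[of _ H]) (auto simp: H_def compose_def)
qed

text \<open>The predicate of \<open>homotopic_with\<close> holds at every time, so the homotopy
  itself carries the cylinder on the subspace into \<open>T\<close>.\<close>

lemma homotopic_with_subtopologies:
  assumes "homotopic_with (\<lambda>h. h \<in> topspace X \<inter> S \<rightarrow> T) X Y f g"
  shows "homotopic_with (\<lambda>h. True) (subtopology X S) (subtopology Y T) f g"
proof -
  obtain h where h: "continuous_map (prod_topology (top_of_set {0..1::real}) X) Y h"
    "\<And>x. h (0, x) = f x" "\<And>x. h (1, x) = g x" "\<And>t. t \<in> {0..1} \<Longrightarrow> (\<lambda>x. h (t, x)) \<in> topspace X \<inter> S \<rightarrow> T"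
    using assms unfolding homotopic_with_def by blast
  have "continuous_map (prod_topology (top_of_set {0..1::real}) (subtopology X S)) (subtopology Y T) h"
    unfolding continuous_map_in_subtopology
  proof
    show "continuous_map (prod_topology (top_of_set {0..1}) (subtopology X S)) Y h"
      using continuous_map_from_subtopology[OF h(1), of "UNIV \<times> S"] by (simp add: subtopology_Times)
  qed (use h(4) in fastforce)
  then show ?thesis
    unfolding homotopic_with_def using h(2,3) by blast
qed

text \<open>Post-composition with \<open>f\<close> and with \<open>g\<close> gives mutually inverse
  maps up to homotopy. The basepoint conditions on \<open>f\<close>, \<open>g\<close> and both
  homotopies let the same data restrict to based maps.\<close>

lemma homotopy_equivalent_mapping_space:
  assumes f: "continuous_map Y Z f" "f y = z" and g: "continuous_map Z Y g" "g z = y"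
    and gf: "homotopic_with (\<lambda>h. h y = y) Y Y (g \<circ> f) id"
    and fg: "homotopic_with (\<lambda>h. h z = z) Z Z (f \<circ> g) id"
    and x: "x \<in> topspace X"
  shows "mapping_space X Y homotopy_equivalent_space mapping_space X Z"
    and "based_mapping_space X x Y y homotopy_equivalent_space based_mapping_space X x Z z"
proof -
  let ?F = "compose (topspace X) f" and ?G = "compose (topspace X) g"
  have FG: "homotopic_with (\<lambda>h. h \<in> topspace (mapping_space X A) \<inter> {\<phi>. \<phi> x = c} \<rightarrow> {\<phi>. \<phi> x = c})
      (mapping_space X A) (mapping_space X A) (compose (topspace X) k \<circ> compose (topspace X) l) id"
    if "homotopic_with (\<lambda>h. h c = c) A A (k \<circ> l) id" for A c k l
  proof (rule homotopic_with_eq[OF homotopic_with_mono[OF homotopic_mapping_space_compose[OF that(1) x]]])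
    fix \<phi> assume "\<phi> \<in> topspace (mapping_space X A)"
    then show "id \<phi> = compose (topspace X) id \<phi>"
      by (intro extensionalityI[of _ "topspace X"]) (auto dest: continuous_mapsD simp: compose_eq)
  qed (use x in \<open>auto simp: compose_def fun_eq_iff Pi_iff\<close>)
  show "mapping_space X Y homotopy_equivalent_space mapping_space X Z"
    unfolding homotopy_equivalent_space_def
    by (intro exI[of _ ?F] exI[of _ ?G] conjI continuous_map_mapping_space_compose f(1) g(1)
        homotopic_with_mono[OF FG[OF gf]] homotopic_with_mono[OF FG[OF fg]] TrueI)
  have "?F \<in> {\<phi>. \<phi> x = y} \<rightarrow> {\<phi>. \<phi> x = z}" "?G \<in> {\<phi>. \<phi> x = z} \<rightarrow> {\<phi>. \<phi> x = y}"
    using f(2) g(2) x by (auto simp: compose_def)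
  then have "continuous_map (based_mapping_space X x Y y) (based_mapping_space X x Z z) ?F"
    "continuous_map (based_mapping_space X x Z z) (based_mapping_space X x Y y) ?G"
    unfolding based_mapping_space_def continuous_map_in_subtopology
    by (auto intro!: continuous_map_from_subtopology continuous_map_mapping_space_compose f(1) g(1))
  then show "based_mapping_space X x Y y homotopy_equivalent_space based_mapping_space X x Z z"
    unfolding homotopy_equivalent_space_def
    using homotopic_with_subtopologies[OF FG[OF gf]] homotopic_with_subtopologies[OF FG[OF fg]]
    unfolding based_mapping_space_def
    by (intro exI[of _ ?F] exI[of _ ?G] conjI)
qed


section \<open>Gauge groups of bundles with abelian structure group\<close>

locale abelian_principal_bundle = comm_group G
  for G :: "('g, 'b) monoid_scheme" (structure) +
  fixes T :: "'g topology" and P :: "'p topology" and X :: "'x topology"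
    and \<pi> :: "'p \<Rightarrow> 'x" and act :: "'p \<Rightarrow> 'g \<Rightarrow> 'p"
  assumes principal: "principal_bundle G T P X \<pi> act"
begin

section \<open>Local sections and fibres of the bundle\<close>

lemma topspace_T [simp]: "topspace T = carrier G"
  using principal by (simp add: principal_bundle_def topological_group_def)

lemma continuous_inv: "continuous_map T T (\<lambda>a. inv a)"
  using principal by (simp add: principal_bundle_def topological_group_def)

lemma continuous_proj: "continuous_map P X \<pi>"
  using principal by (simp add: principal_bundle_def)

lemma continuous_act: "continuous_map (prod_topology P T) P (\<lambda>(p, a). act p a)"
  using principal by (simp add: principal_bundle_def)

lemma proj_closed [simp]: "p \<in> topspace P \<Longrightarrow> \<pi> p \<in> topspace X"
  by (rule funcset_mem[OF continuous_map_funspace[OF continuous_proj]])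

lemma act_closed [simp]: "\<lbrakk>p \<in> topspace P; a \<in> carrier G\<rbrakk> \<Longrightarrow> act p a \<in> topspace P"
  using funcset_mem[OF continuous_map_funspace[OF continuous_act], of "(p, a)"] by simp

lemma act_one [simp]: "p \<in> topspace P \<Longrightarrow> act p \<one> = p"
  using principal by (simp add: principal_bundle_def)

lemma act_act: "\<lbrakk>p \<in> topspace P; a \<in> carrier G; b \<in> carrier G\<rbrakk> \<Longrightarrow> act (act p a) b = act p (a \<otimes> b)"
  using principal by (simp add: principal_bundle_def)

lemma proj_act [simp]: "\<lbrakk>p \<in> topspace P; a \<in> carrier G\<rbrakk> \<Longrightarrow> \<pi> (act p a) = \<pi> p"
  using principal by (simp add: principal_bundle_def)

text \<open>A trivialization \<open>h\<close> yields the section \<open>s y = h (y, \<one>)\<close>,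
  and equivariance recovers \<open>h (y, a)\<close> as \<open>act (s y) a\<close>. Bijectivity of
  \<open>h\<close> becomes unique translation from the section, and its openness becomes the last
  property.\<close>

lemma local_section:
  assumes x: "x \<in> topspace X"
  obtains U s where "openin X U" "x \<in> U" "continuous_map (subtopology X U) P s"
    "\<forall>y\<in>U. s y \<in> topspace P \<and> \<pi> (s y) = y"
    "\<forall>p\<in>topspace P. \<pi> p \<in> U \<longrightarrow> (\<exists>!a. a \<in> carrier G \<and> act (s (\<pi> p)) a = p)"
    "\<forall>A. openin T A \<longrightarrow> openin P {act (s y) a | y a. y \<in> U \<and> a \<in> A}"
proof -
  let ?Q = "\<lambda>U. subtopology P {p \<in> topspace P. \<pi> p \<in> U}"
  have "\<exists>U h. openin X U \<and> x \<in> U \<and>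
        homeomorphic_map (prod_topology (subtopology X U) T) (?Q U) h \<and>
        (\<forall>y\<in>U. \<forall>a\<in>carrier G. \<pi> (h (y, a)) = y) \<and>
        (\<forall>y\<in>U. \<forall>a\<in>carrier G. \<forall>b\<in>carrier G. act (h (y, a)) b = h (y, a \<otimes> b))"
    using principal x unfolding principal_bundle_def by blast
  then obtain U h where U: "openin X U" "x \<in> U"
    and h: "homeomorphic_map (prod_topology (subtopology X U) T) (?Q U) h"
    and proj_h: "\<forall>y\<in>U. \<forall>a\<in>carrier G. \<pi> (h (y, a)) = y"
    and act_h: "\<forall>y\<in>U. \<forall>a\<in>carrier G. \<forall>b\<in>carrier G. act (h (y, a)) b = h (y, a \<otimes> b)"
    by (elim exE conjE) (rule that)
  have UX: "U \<subseteq> topspace X" by (rule openin_subset[OF U(1)])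
  have top: "topspace (prod_topology (subtopology X U) T) = U \<times> carrier G"
    using UX by auto
  have inj: "inj_on h (U \<times> carrier G)"
    using homeomorphic_imp_injective_map[OF h] by (simp only: top)
  have im: "h ` (U \<times> carrier G) = {p \<in> topspace P. \<pi> p \<in> U}"
    using homeomorphic_imp_surjective_map[OF h] unfolding top by auto
  define s where "s y = h (y, \<one>)" for y
  have act_s: "act (s y) a = h (y, a)" if "y \<in> U" "a \<in> carrier G" for y a
    using that by (simp add: s_def act_h)
  show thesis
  proof (rule that[OF U, of s]; (intro ballI allI impI)?)
    have "continuous_map (prod_topology (subtopology X U) T) P h"
      using homeomorphic_imp_continuous_map[OF h] by (simp add: continuous_map_in_subtopology)
    moreover have "continuous_map (subtopology X U) (prod_topology (subtopology X U) T) (\<lambda>y. (y, \<one>))"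
      by (intro continuous_map_pairedI) (auto simp: continuous_map_id[unfolded id_def])
    ultimately show s: "continuous_map (subtopology X U) P s"
      unfolding s_def[abs_def] by (rule continuous_map_compose[unfolded comp_def, rotated])
    show "s y \<in> topspace P \<and> \<pi> (s y) = y" if y: "y \<in> U" for y
      using funcset_mem[OF continuous_map_funspace[OF s]] y UX by (auto simp: s_def proj_h)
    show "\<exists>!a. a \<in> carrier G \<and> act (s (\<pi> p)) a = p" if p: "p \<in> topspace P" "\<pi> p \<in> U" for p
    proof -
      obtain y a where ya: "y \<in> U" "a \<in> carrier G" "p = h (y, a)"
        using p im by (metis (mono_tags, lifting) imageE mem_Collect_eq mem_Sigma_iff surj_pair)
      then have y: "\<pi> p = y" by (simp add: proj_h)
      show ?thesis
      proof (rule ex1I[of _ a])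
        show "a \<in> carrier G \<and> act (s (\<pi> p)) a = p" using ya y by (simp add: act_s)
        fix b assume "b \<in> carrier G \<and> act (s (\<pi> p)) b = p"
        then have "b \<in> carrier G" "h (y, b) = h (y, a)" using ya y act_s[of y b] by simp_all
        then show "b = a" using inj_onD[OF inj, of "(y, b)" "(y, a)"] ya by simp
      qed
    qed
    show "openin P {act (s y) a | y a. y \<in> U \<and> a \<in> A}" if A: "openin T A" for A
    proof -
      have AG: "A \<subseteq> carrier G" using openin_subset[OF A] by simp
      have "openin (prod_topology (subtopology X U) T) (U \<times> A)"
        using A U(1) by (simp add: openin_prod_Times_iff openin_subtopology_refl UX)
      then have "openin (?Q U) (h ` (U \<times> A))"
        using homeomorphic_imp_open_map[OF h] unfolding open_map_def by blast
      then have "openin P (h ` (U \<times> A))"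
        using openin_trans_full openin_continuous_map_preimage[OF continuous_proj U(1)] by blast
      moreover have "h ` (U \<times> A) = {act (s y) a | y a. y \<in> U \<and> a \<in> A}"
      proof (intro equalityI subsetI)
        fix p assume "p \<in> h ` (U \<times> A)"
        then obtain y a where "y \<in> U" "a \<in> A" "p = h (y, a)" by blast
        then show "p \<in> {act (s y) a | y a. y \<in> U \<and> a \<in> A}"
          using AG by (intro CollectI exI[of _ y] exI[of _ a]) (auto simp: act_s)
      next
        fix p assume "p \<in> {act (s y) a | y a. y \<in> U \<and> a \<in> A}"
        then obtain y a where "y \<in> U" "a \<in> A" "p = act (s y) a" by blast
        then show "p \<in> h ` (U \<times> A)"
          using AG by (intro image_eqI[of _ _ "(y, a)"]) (auto simp: act_s)
      qed
      ultimately show ?thesis by simp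
    qed
  qed
qed

text \<open>Both points are translates of the section value in their fibre, by \<open>c\<close> and
  \<open>d\<close> say, so \<open>inv c \<otimes> d\<close> is the only element taking
  \<open>p\<close> to \<open>q\<close>.\<close>

lemma fibre_transitive:
  assumes p: "p \<in> topspace P" and q: "q \<in> topspace P" and pq: "\<pi> p = \<pi> q"
  shows "\<exists>!a. a \<in> carrier G \<and> act p a = q"
proof -
  obtain U s where U: "\<pi> p \<in> U" and s: "\<forall>y\<in>U. s y \<in> topspace P \<and> \<pi> (s y) = y"
    and ex: "\<forall>p\<in>topspace P. \<pi> p \<in> U \<longrightarrow> (\<exists>!a. a \<in> carrier G \<and> act (s (\<pi> p)) a = p)"
    by (rule local_section[OF proj_closed[OF p]]) (rule that)
  have sp: "s (\<pi> p) \<in> topspace P" using s U by blast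
  obtain c where c: "c \<in> carrier G" "act (s (\<pi> p)) c = p"
    using ex p U by blast
  have unique: "a = b" if "a \<in> carrier G" "b \<in> carrier G"
    "act (s (\<pi> p)) a = q" "act (s (\<pi> p)) b = q" for a b
    using ex q U that unfolding pq by blast
  obtain d where d: "d \<in> carrier G" "act (s (\<pi> p)) d = q"
    using ex q U unfolding pq by blast
  have act_p: "act p a = act (s (\<pi> p)) (c \<otimes> a)" if "a \<in> carrier G" for a
    using act_act[OF sp c(1) that] c(2) by simp
  show ?thesis
  proof (rule ex1I[of _ "inv c \<otimes> d"])
    show "inv c \<otimes> d \<in> carrier G \<and> act p (inv c \<otimes> d) = q"
      using c(1) d by (simp add: act_p m_assoc[symmetric])
    fix b assume b: "b \<in> carrier G \<and> act p b = q"
    then have "act (s (\<pi> p)) (c \<otimes> b) = q" using act_p[of b] by simp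
    then have "c \<otimes> b = d"
      using b c(1) d by (intro unique) simp_all
    then show "b = inv c \<otimes> d"
      using b c(1) by (auto simp: m_assoc[symmetric])
  qed
qed

lemma fibre_nonempty:
  assumes "x \<in> topspace X"
  obtains p where "p \<in> topspace P" "\<pi> p = x"
proof -
  obtain U s where "x \<in> U" "\<forall>y\<in>U. s y \<in> topspace P \<and> \<pi> (s y) = y"
    by (rule local_section[OF assms]) (rule that)
  then show thesis by (intro that[of "s x"]) blast+
qed

section \<open>The correspondence between gauge transformations and maps to the structure
  group\<close>

definition gauge_of :: "('x \<Rightarrow> 'g) \<Rightarrow> 'p \<Rightarrow> 'p" where
  "gauge_of f = (\<lambda>p\<in>topspace P. act p (f (\<pi> p)))"

text \<open>Quantifying over the whole fibre avoids choosing a point in it. The description is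
  meaningful for gauge transformations because the structure group is commutative and acts freely on
  nonempty fibres.\<close>

definition map_of_gauge :: "('p \<Rightarrow> 'p) \<Rightarrow> 'x \<Rightarrow> 'g" where
  "map_of_gauge \<eta> = (\<lambda>x\<in>topspace X.
     THE a. a \<in> carrier G \<and> (\<forall>p\<in>topspace P. \<pi> p = x \<longrightarrow> \<eta> p = act p a))"

lemma continuous_maps_closed [simp]:
  "\<lbrakk>f \<in> continuous_maps X T; x \<in> topspace X\<rbrakk> \<Longrightarrow> f x \<in> carrier G"
  using funcset_mem[OF continuous_map_funspace[OF continuous_mapsD(1)], of f X T x] by simp

lemma gauge_of_apply: "p \<in> topspace P \<Longrightarrow> gauge_of f p = act p (f (\<pi> p))"
  by (simp add: gauge_of_def)

text \<open>\<open>f\<close> is first pulled back along \<open>\<pi>\<close>, then the action is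
  applied fibrewise. The target is all of \<open>mapping_space P P\<close>, so that continuity of
  each \<open>gauge_of f\<close> can be read off before it is known to be a gauge
  transformation.\<close>

lemma continuous_gauge_of: "continuous_map (mapping_space X T) (mapping_space P P) gauge_of"
proof -
  have "continuous_map (prod_topology (mapping_space X T) (prod_topology P T)) P (\<lambda>(w, p, a). act p a)"
    using continuous_map_compose[OF continuous_map_snd continuous_act]
    by (simp add: comp_def case_prod_unfold)
  from continuous_map_mapping_space_fibrewise[OF this
      continuous_map_mapping_space_precompose[OF continuous_proj]]
  show ?thesis
    by (rule continuous_map_eq) (simp add: gauge_of_def restrict_def fun_eq_iff)
qed

lemma gauge_groupD:
  assumes "\<eta> \<in> carrier (gauge_group G P \<pi> act)"
  shows "continuous_map P P \<eta>" "\<eta> \<in> extensional (topspace P)"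
    and "\<lbrakk>p \<in> topspace P; a \<in> carrier G\<rbrakk> \<Longrightarrow> \<eta> (act p a) = act (\<eta> p) a"
    and "p \<in> topspace P \<Longrightarrow> \<pi> (\<eta> p) = \<pi> p"
    and "p \<in> topspace P \<Longrightarrow> \<eta> p \<in> topspace P"
  using assms Bij_imp_funcset
  by (auto simp: gauge_group_def Bij_def homeomorphic_imp_continuous_map dest: bij_betwE)

text \<open>The inverse of \<open>gauge_of f\<close> comes from the pointwise inverse of
  \<open>f\<close>. Equivariance needs \<open>a\<close> and \<open>f (\<pi> p)\<close> to
  commute.\<close>

lemma gauge_of_in_gauge_group:
  assumes f: "f \<in> continuous_maps X T"
  shows "gauge_of f \<in> carrier (gauge_group G P \<pi> act)"
proof -
  have cont: "continuous_map P P (gauge_of g)" if "g \<in> continuous_maps X T" for g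
    using funcset_mem[OF continuous_map_funspace[OF continuous_gauge_of], of g] that
    by (simp add: continuous_maps_def)
  define g where "g = (\<lambda>x\<in>topspace X. inv (f x))"
  have g: "g \<in> continuous_maps X T"
    unfolding g_def
    by (intro restrict_in_continuous_maps
        continuous_map_compose[OF continuous_mapsD(1)[OF f] continuous_inv, unfolded comp_def])
  have "gauge_of g (gauge_of f p) = p" "gauge_of f (gauge_of g p) = p" if "p \<in> topspace P" for p
    using that f g by (simp_all add: gauge_of_apply act_act) (simp_all add: g_def)
  then have "homeomorphic_maps P P (gauge_of f) (gauge_of g)"
    unfolding homeomorphic_maps_def using cont f g by blast
  then have hom: "homeomorphic_map P P (gauge_of f)"
    unfolding homeomorphic_map_maps by blast
  then have "gauge_of f \<in> Bij (topspace P)"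
    using homeomorphic_imp_injective_map[OF hom] homeomorphic_imp_surjective_map[OF hom]
    by (simp add: Bij_def bij_betw_def) (simp add: gauge_of_def)
  moreover have "gauge_of f (act p a) = act (gauge_of f p) a" "\<pi> (gauge_of f p) = \<pi> p"
    if "p \<in> topspace P" "a \<in> carrier G" for p a
    using that f by (simp_all add: gauge_of_apply act_act m_comm)
  ultimately show ?thesis
    \<comment> \<open>The projection claim was also proved under \<open>a \<in> carrier G\<close>;
      \<open>one_closed\<close> discharges that premise.\<close>
    using hom one_closed unfolding gauge_group_def by (simp, blast)
qed

text \<open>Commutativity makes the translation \<open>\<eta> p = act p a\<close> constant along each fibre.\<close>

lemma map_of_gauge_eqI:
  assumes \<eta>: "\<eta> \<in> carrier (gauge_group G P \<pi> act)"
    and p: "p \<in> topspace P" and a: "a \<in> carrier G" and eq: "\<eta> p = act p a"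
  shows "map_of_gauge \<eta> (\<pi> p) = a"
proof -
  have "\<eta> q = act q a" if q: "q \<in> topspace P" "\<pi> q = \<pi> p" for q
  proof -
    obtain b where "b \<in> carrier G" "act p b = q"
      using fibre_transitive[OF p q(1) q(2)[symmetric]] by blast
    then show ?thesis
      using gauge_groupD(3)[OF \<eta> p] p a eq by (metis act_act m_comm)
  qed
  \<comment> \<open>Freeness of the action gives the uniqueness demanded by the definite
    description.\<close>
  moreover have "b = a" if "b \<in> carrier G" "act p b = act p a" for b
    using fibre_transitive[of p "act p a"] p a that by auto
  ultimately have "(THE b. b \<in> carrier G \<and> (\<forall>q\<in>topspace P. \<pi> q = \<pi> p \<longrightarrow> \<eta> q = act q b)) = a"
    using p a eq by (intro the_equality) auto
  then show ?thesis
    using p by (simp add: map_of_gauge_def)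
qed

lemma map_of_gauge_apply:
  assumes \<eta>: "\<eta> \<in> carrier (gauge_group G P \<pi> act)" and p: "p \<in> topspace P"
  shows "map_of_gauge \<eta> (\<pi> p) \<in> carrier G" "act p (map_of_gauge \<eta> (\<pi> p)) = \<eta> p"
proof -
  obtain a where "a \<in> carrier G" "act p a = \<eta> p"
    using fibre_transitive[OF p gauge_groupD(5)[OF \<eta> p] gauge_groupD(4)[OF \<eta> p, symmetric]] by blast
  then show "map_of_gauge \<eta> (\<pi> p) \<in> carrier G" "act p (map_of_gauge \<eta> (\<pi> p)) = \<eta> p"
    using map_of_gauge_eqI[OF \<eta> p] by auto
qed

text \<open>Take for \<open>B\<close> the translates of the section by elements of \<open>A\<close>.
  Since \<open>B\<close> depends neither on \<open>\<eta>\<close> nor on \<open>y\<close>, it yields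
  continuity of each single \<open>map_of_gauge \<eta>\<close> and also continuity in
  \<open>\<eta>\<close>.\<close>

lemma local_section_map_of_gauge:
  assumes x: "x \<in> topspace X"
  obtains U s where "openin X U" "x \<in> U" "continuous_map (subtopology X U) P s"
    "\<forall>A. openin T A \<longrightarrow> (\<exists>B. openin P B \<and> (\<forall>\<eta>\<in>carrier (gauge_group G P \<pi> act). \<forall>y\<in>U.
       map_of_gauge \<eta> y \<in> A \<longleftrightarrow> \<eta> (s y) \<in> B))"
proof -
  obtain U s where U: "openin X U" "x \<in> U"
    and s: "continuous_map (subtopology X U) P s" "\<forall>y\<in>U. s y \<in> topspace P \<and> \<pi> (s y) = y"
    and op: "\<forall>A. openin T A \<longrightarrow> openin P {act (s y) a | y a. y \<in> U \<and> a \<in> A}"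
    by (rule local_section[OF x]) (rule that)
  from s(2) have sP: "s y \<in> topspace P" and \<pi>s: "\<pi> (s y) = y" if "y \<in> U" for y
    using that by blast+
  have sat: "map_of_gauge \<eta> y \<in> A \<longleftrightarrow> \<eta> (s y) \<in> {act (s y) a | y a. y \<in> U \<and> a \<in> A}"
    if A: "openin T A" and \<eta>: "\<eta> \<in> carrier (gauge_group G P \<pi> act)" and y: "y \<in> U" for A \<eta> y
  proof
    note translate = map_of_gauge_apply[OF \<eta> sP[OF y], unfolded \<pi>s[OF y]]
    {
      assume "map_of_gauge \<eta> y \<in> A"
      then show "\<eta> (s y) \<in> {act (s y) a | y a. y \<in> U \<and> a \<in> A}"
        using y translate(2)[symmetric] by blast
    next
      assume "\<eta> (s y) \<in> {act (s y) a | y a. y \<in> U \<and> a \<in> A}"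
      then obtain y' a where a: "\<eta> (s y) = act (s y') a" "y' \<in> U" "a \<in> A" by blast
      have aG: "a \<in> carrier G" using a(3) openin_subset[OF A] by auto
      \<comment> \<open>Projecting to the base identifies the two points, as \<open>\<eta>\<close>
        and the action preserve fibres.\<close>
      have "y' = y"
        using gauge_groupD(4)[OF \<eta> sP[OF y]] a aG sP y by (simp add: \<pi>s)
      then have "map_of_gauge \<eta> (\<pi> (s y)) = a"
        using a aG by (intro map_of_gauge_eqI[OF \<eta> sP[OF y]]) simp_all
      then show "map_of_gauge \<eta> y \<in> A"
        using a(3) y by (simp add: \<pi>s)
    }
  qed
  show thesis
  proof (rule that[OF U s(1)], intro allI impI)
    fix A assume A: "openin T A"
    show "\<exists>B. openin P B \<and> (\<forall>\<eta>\<in>carrier (gauge_group G P \<pi> act). \<forall>y\<in>U.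
        map_of_gauge \<eta> y \<in> A \<longleftrightarrow> \<eta> (s y) \<in> B)"
      by (intro exI conjI ballI, rule op[rule_format, OF A]) (rule sat[OF A])
  qed
qed

text \<open>Over the domain of a local section \<open>s\<close>, the preimage of an open
  \<open>A\<close> is the preimage of an open \<open>B\<close> under the continuous map
  \<open>\<eta> \<circ> s\<close>.\<close>

lemma map_of_gauge_in_continuous_maps:
  assumes \<eta>: "\<eta> \<in> carrier (gauge_group G P \<pi> act)"
  shows "map_of_gauge \<eta> \<in> continuous_maps X T"
proof -
  have closed: "map_of_gauge \<eta> x \<in> carrier G" if x: "x \<in> topspace X" for x
  proof -
    obtain p where "p \<in> topspace P" "\<pi> p = x" by (rule fibre_nonempty[OF x])
    then show ?thesis
      using map_of_gauge_apply(1)[OF \<eta>] by metis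
  qed
  have op: "openin X {x \<in> topspace X. map_of_gauge \<eta> x \<in> A}" if A: "openin T A" for A
  proof (subst openin_subopen, intro ballI)
    fix x assume x: "x \<in> {x \<in> topspace X. map_of_gauge \<eta> x \<in> A}"
    then have "x \<in> topspace X" by simp
    then obtain U s where U: "openin X U" "x \<in> U"
      and s: "continuous_map (subtopology X U) P s"
      and B: "\<forall>A. openin T A \<longrightarrow> (\<exists>B. openin P B \<and> (\<forall>\<eta>\<in>carrier (gauge_group G P \<pi> act). \<forall>y\<in>U.
        map_of_gauge \<eta> y \<in> A \<longleftrightarrow> \<eta> (s y) \<in> B))"
      by (rule local_section_map_of_gauge) (rule that)
    obtain B where B: "openin P B" "\<forall>\<eta>\<in>carrier (gauge_group G P \<pi> act). \<forall>y\<in>U.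
        map_of_gauge \<eta> y \<in> A \<longleftrightarrow> \<eta> (s y) \<in> B"
      using mp[OF spec[OF B] A] by (elim exE conjE) (rule that)
    have UX: "U \<subseteq> topspace X" by (rule openin_subset[OF U(1)])
    have "openin (subtopology X U) {y \<in> topspace (subtopology X U). (\<eta> \<circ> s) y \<in> B}"
      by (rule openin_continuous_map_preimage[OF
            continuous_map_compose[OF s gauge_groupD(1)[OF \<eta>]] B(1)])
    then have "openin X {y \<in> topspace (subtopology X U). (\<eta> \<circ> s) y \<in> B}"
      by (rule openin_trans_full[OF _ U(1)])
    moreover have "{y \<in> topspace (subtopology X U). (\<eta> \<circ> s) y \<in> B} = {y \<in> U. map_of_gauge \<eta> y \<in> A}"
      using UX B(2)[rule_format, OF \<eta>] by auto
    ultimately have "openin X {y \<in> U. map_of_gauge \<eta> y \<in> A}" by simp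
    then show "\<exists>N. openin X N \<and> x \<in> N \<and> N \<subseteq> {x \<in> topspace X. map_of_gauge \<eta> x \<in> A}"
      using x U(2) UX by (intro exI[of _ "{y \<in> U. map_of_gauge \<eta> y \<in> A}"]) auto
  qed
  have "continuous_map X T (map_of_gauge \<eta>)"
    unfolding continuous_map_def topspace_T by (intro conjI funcsetI allI impI closed op)
  then show ?thesis
    by (simp add: continuous_maps_def) (simp add: map_of_gauge_def)
qed

text \<open>Along a local section, a condition on \<open>map_of_gauge \<zeta>\<close> becomes a
  condition on \<open>\<zeta>\<close> over a test set in \<open>P\<close>. Sections exist only
  locally, so the test space has to be cut into closed pieces lying over their domains.\<close>

lemma continuous_map_of_gauge:
  "continuous_map (gauge_space G P \<pi> act) (mapping_space X T) map_of_gauge"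
proof (rule continuous_map_into_mapping_spaceI)
  have top: "topspace (gauge_space G P \<pi> act) = carrier (gauge_group G P \<pi> act)"
    using gauge_groupD(1,2) by (auto simp: gauge_space_def continuous_maps_def)
  then show "map_of_gauge \<eta> \<in> continuous_maps X T" if "\<eta> \<in> topspace (gauge_space G P \<pi> act)" for \<eta>
    using that by (simp add: map_of_gauge_in_continuous_maps)
  fix L :: "'x set set topology" and u A \<eta> l
  assume L: "compact_space L" "Hausdorff_space L" and u: "continuous_map L X u"
    and A: "openin T A" and "\<eta> \<in> topspace (gauge_space G P \<pi> act)" and l: "l \<in> topspace L"
    and "map_of_gauge \<eta> (u l) \<in> A"
  then have \<eta>: "\<eta> \<in> carrier (gauge_group G P \<pi> act)" by (simp add: top)
  have "u l \<in> topspace X" by (rule funcset_mem[OF continuous_map_funspace[OF u] l])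
  then obtain U s where U: "openin X U" "u l \<in> U"
    and s: "continuous_map (subtopology X U) P s"
    and *: "\<forall>A. openin T A \<longrightarrow> (\<exists>B. openin P B \<and> (\<forall>\<eta>\<in>carrier (gauge_group G P \<pi> act). \<forall>y\<in>U.
      map_of_gauge \<eta> y \<in> A \<longleftrightarrow> \<eta> (s y) \<in> B))"
    by (rule local_section_map_of_gauge) (rule that)
  obtain B where B: "openin P B"
    "\<forall>\<zeta>\<in>carrier (gauge_group G P \<pi> act). \<forall>y\<in>U. map_of_gauge \<zeta> y \<in> A \<longleftrightarrow> \<zeta> (s y) \<in> B"
    using mp[OF spec[OF *] A] by (elim exE conjE) (rule that)
  let ?V = "{k \<in> topspace L. u k \<in> U}"
  have V: "openin L ?V" by (rule openin_continuous_map_preimage[OF u U(1)])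
  have lV: "l \<in> ?V" using l U(2) by simp
  have key: "\<exists>N. openin (gauge_space G P \<pi> act) N \<and> \<eta> \<in> N \<and> (\<forall>\<zeta>\<in>N. map_of_gauge \<zeta> ` u ` D \<subseteq> A)"
    if D: "closedin L D" "D \<subseteq> ?V" and sub: "map_of_gauge \<eta> ` u ` D \<subseteq> A" for D
  proof -
    have "continuous_map (subtopology L D) (subtopology X U) u"
      unfolding continuous_map_in_subtopology
      using u D(2) by (auto simp: continuous_map_from_subtopology)
    from continuous_map_compose[OF this s]
    have "compact_test_set P ((s \<circ> u) ` D)"
      by (rule compact_test_set_image_closedin[OF L D(1)])
    from openin_mapping_space[OF this B(1)]
    have "openin (gauge_space G P \<pi> act) ({\<zeta> \<in> continuous_maps P P. \<zeta> ` (s \<circ> u) ` D \<subseteq> B} \<inter>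
        carrier (gauge_group G P \<pi> act))" (is "openin _ ?N")
      unfolding gauge_space_def by (rule openin_subtopology_Int)
    \<comment> \<open>The open set of gauge transformations is exactly the one described by the
      condition on \<open>map_of_gauge\<close>.\<close>
    moreover have N_iff: "\<zeta> \<in> ?N \<longleftrightarrow> \<zeta> \<in> carrier (gauge_group G P \<pi> act) \<and> map_of_gauge \<zeta> ` u ` D \<subseteq> A" for \<zeta>
    proof (cases "\<zeta> \<in> carrier (gauge_group G P \<pi> act)")
      case True
      then have "\<zeta> \<in> continuous_maps P P" using gauge_groupD(1,2) by (simp add: continuous_maps_def)
      moreover have "map_of_gauge \<zeta> ` u ` D \<subseteq> A \<longleftrightarrow> \<zeta> ` (s \<circ> u) ` D \<subseteq> B"
        unfolding image_subset_iff ball_simps(9) comp_def using B(2)[rule_format, OF True] D(2) by auto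
      ultimately show ?thesis using True by simp
    qed simp
    ultimately show ?thesis
      using \<eta> sub by (intro exI[of _ ?N] conjI ballI) (simp_all only: N_iff)
  qed
  from V lV show "\<exists>V. openin L V \<and> l \<in> V \<and> (\<forall>D. closedin L D \<and> D \<subseteq> V \<and> map_of_gauge \<eta> ` u ` D \<subseteq> A \<longrightarrow>
      (\<exists>N. openin (gauge_space G P \<pi> act) N \<and> \<eta> \<in> N \<and> (\<forall>\<zeta>\<in>N. map_of_gauge \<zeta> ` u ` D \<subseteq> A)))"
    by (intro exI[of _ ?V] conjI allI impI; (elim conjE)?) (assumption | rule key)+
qed

text \<open>Both composites are identities because the translation of each fibre is unique;
  extensionality then turns pointwise agreement into equality.\<close>

lemma homeomorphic_maps_gauge_space:
  "homeomorphic_maps (mapping_space X T) (gauge_space G P \<pi> act) gauge_of map_of_gauge"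
  unfolding homeomorphic_maps_def
proof (intro conjI ballI)
  show "continuous_map (mapping_space X T) (gauge_space G P \<pi> act) gauge_of"
    unfolding gauge_space_def continuous_map_in_subtopology
    using continuous_gauge_of gauge_of_in_gauge_group by auto
  show "continuous_map (gauge_space G P \<pi> act) (mapping_space X T) map_of_gauge"
    by (rule continuous_map_of_gauge)
  show "map_of_gauge (gauge_of f) = f" if "f \<in> topspace (mapping_space X T)" for f
  proof (rule continuous_maps_eqI)
    have f: "f \<in> continuous_maps X T" using that by simp
    then show "f \<in> continuous_maps X T" "map_of_gauge (gauge_of f) \<in> continuous_maps X T"
      by (simp_all add: map_of_gauge_in_continuous_maps gauge_of_in_gauge_group)
    fix x assume x: "x \<in> topspace X"
    obtain p where p: "p \<in> topspace P" "\<pi> p = x" by (rule fibre_nonempty[OF x])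
    then show "map_of_gauge (gauge_of f) x = f x"
      using map_of_gauge_eqI[OF gauge_of_in_gauge_group[OF f] p(1), of "f x"] f x
      by (simp add: gauge_of_apply)
  qed
  show "gauge_of (map_of_gauge \<eta>) = \<eta>" if "\<eta> \<in> topspace (gauge_space G P \<pi> act)" for \<eta>
  proof -
    have "\<eta> \<in> carrier (gauge_group G P \<pi> act)" using that by (simp add: gauge_space_def)
    then show ?thesis
      by (intro extensionalityI[of _ "topspace P"])
        (simp_all add: gauge_of_def map_of_gauge_apply(2) gauge_groupD(2))
  qed
qed

lemma gauge_space_homeomorphic: "gauge_space G P \<pi> act homeomorphic_space mapping_space X T"
  using homeomorphic_maps_gauge_space homeomorphic_maps_sym homeomorphic_space_def by blast

lemma based_gauge_space_homeomorphic:
  assumes x: "x \<in> topspace X"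
  shows "based_gauge_space G P \<pi> act x homeomorphic_space based_mapping_space X x T \<one>"
proof -
  let ?\<G>\<^sub>0 = "carrier (based_gauge_group G P \<pi> act x)"
  have based_iff: "\<eta> \<in> ?\<G>\<^sub>0 \<longleftrightarrow> \<eta> \<in> carrier (gauge_group G P \<pi> act) \<and>
      (\<forall>p\<in>topspace P. \<pi> p = x \<longrightarrow> \<eta> p = p)" for \<eta>
    by (simp add: based_gauge_group_def)
  \<comment> \<open>A single point over \<open>x\<close> suffices: if \<open>\<eta>\<close> fixes
    it, then \<open>map_of_gauge \<eta>\<close> takes the value \<open>\<one>\<close> at
    \<open>x\<close>.\<close>
  obtain p where p: "p \<in> topspace P" "\<pi> p = x" by (rule fibre_nonempty[OF x])
  have "homeomorphic_maps (subtopology (mapping_space X T) {f. f x = \<one>})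
      (subtopology (gauge_space G P \<pi> act) ?\<G>\<^sub>0) gauge_of map_of_gauge"
  proof (rule homeomorphic_maps_subtopologies_alt[OF homeomorphic_maps_gauge_space])
    show "gauge_of ` (topspace (mapping_space X T) \<inter> {f. f x = \<one>}) \<subseteq> ?\<G>\<^sub>0"
      by (auto simp: based_iff gauge_of_in_gauge_group gauge_of_apply)
    show "map_of_gauge ` (topspace (gauge_space G P \<pi> act) \<inter> ?\<G>\<^sub>0) \<subseteq> {f. f x = \<one>}"
    proof (intro image_subsetI CollectI)
      fix \<eta> assume "\<eta> \<in> topspace (gauge_space G P \<pi> act) \<inter> ?\<G>\<^sub>0"
      then have "\<eta> \<in> carrier (gauge_group G P \<pi> act)" "\<eta> p = act p \<one>"
        using p by (simp_all add: based_iff)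
      from map_of_gauge_eqI[OF this(1) p(1) one_closed this(2)]
      show "map_of_gauge \<eta> x = \<one>" unfolding p(2) .
    qed
  qed
  moreover have "subtopology (gauge_space G P \<pi> act) ?\<G>\<^sub>0 = based_gauge_space G P \<pi> act x"
    unfolding gauge_space_def based_gauge_space_def subtopology_subtopology
    by (rule arg_cong[of _ _ "subtopology _"]) (auto simp: based_iff)
  ultimately show ?thesis
    unfolding based_mapping_space_def[symmetric] homeomorphic_space_def
    using homeomorphic_maps_sym by metis
qed

end


section \<open>Gauge groups as mapping spaces into the product of Eilenberg-MacLane spaces\<close>

theorem proposition25:
  fixes n k :: nat
    and C :: "'c topology" and q :: "'c \<Rightarrow> nat set \<Rightarrow> real"
    and G :: "('g, 'b) monoid_scheme" and T :: "'g topology" and r :: "'c \<Rightarrow> 'g"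
    and I :: "'i set" and m :: "'i \<Rightarrow> nat"
    and K :: "'i \<Rightarrow> 'k topology" and z :: "'i \<Rightarrow> 'k" and \<mu> :: "'i \<Rightarrow> 'k \<Rightarrow> 'k \<Rightarrow> 'k"
    and E :: "'i \<Rightarrow> 'e topology" and e :: "'i \<Rightarrow> 'e"
    and X :: "'x topology" and x\<^sub>0 :: 'x
    and P :: "'p topology" and \<pi> :: "'p \<Rightarrow> 'x" and act :: "'p \<Rightarrow> 'g \<Rightarrow> 'p"
  assumes "connected_cover k C (spin_space n) q"
    and "rationalization C T r"
    and "topological_group G T" and "comm_group G"
    and "\<And>i. i \<in> I \<Longrightarrow> rational_eilenberg_maclane (m i) (K i) (z i)"
    and "\<And>i. i \<in> I \<Longrightarrow> H_space (K i) (z i) (\<mu> i)"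
    and "\<And>i. i \<in> I \<Longrightarrow> rational_eilenberg_maclane (Suc (m i)) (E i) (e i)"
    and "\<And>i. i \<in> I \<Longrightarrow> H_equivalent (K i) (z i) (\<mu> i)
           (loop_space (E i) (e i)) (constant_loop (e i)) loop_mult"
    and "H_equivalent T \<one>\<^bsub>G\<^esub> (\<lambda>a b. a \<otimes>\<^bsub>G\<^esub> b)
           (product_topology K I) (restrict z I) (product_mult I \<mu>)"
    and "x\<^sub>0 \<in> topspace X"
    and "principal_bundle G T P X \<pi> act"
  shows "gauge_space G P \<pi> act homotopy_equivalent_space
           mapping_space X (product_topology K I) \<and>
         based_gauge_space G P \<pi> act x\<^sub>0 homotopy_equivalent_space
           based_mapping_space X x\<^sub>0 (product_topology K I) (restrict z I)"
proof -
  interpret abelian_principal_bundle G T P X \<pi> act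
    using assms(4,11) by (simp add: abelian_principal_bundle_def abelian_principal_bundle_axioms_def)
  \<comment> \<open>The equivalence contained in \<open>H_equivalent\<close> is pointed, with
    \<open>\<one>\<close> corresponding to \<open>restrict z I\<close>; these are the basepoints of
    the two based mapping spaces to be compared.\<close>
  obtain f g where f: "continuous_map T (product_topology K I) f" "f \<one>\<^bsub>G\<^esub> = restrict z I"
    and g: "continuous_map (product_topology K I) T g" "g (restrict z I) = \<one>\<^bsub>G\<^esub>"
    and gf: "pointed_homotopic T \<one>\<^bsub>G\<^esub> T \<one>\<^bsub>G\<^esub> (g \<circ> f) id"
    and fg: "pointed_homotopic (product_topology K I) (restrict z I)
      (product_topology K I) (restrict z I) (f \<circ> g) id"
    using assms(9) unfolding H_equivalent_def by (elim exE conjE) (rule that)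
  note equivalent = homotopy_equivalent_mapping_space[OF f g gf[unfolded pointed_homotopic_def]
      fg[unfolded pointed_homotopic_def] assms(10)]
  show ?thesis
    by (rule conjI)
      (rule homotopy_eqv_trans[OF homeomorphic_imp_homotopy_equivalent_space equivalent(1)]
          homotopy_eqv_trans[OF homeomorphic_imp_homotopy_equivalent_space equivalent(2)],
        rule gauge_space_homeomorphic based_gauge_space_homeomorphic[OF assms(10)])+
qed

end
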